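(* Let $P\in\mathbb{R}_+^{m\times n}$ be a given nonnegative matrix, and let $\boldsymbol{\mathcal{P}}$, $\boldsymbol{\mathcal{Q}}$ (sets of three-index arrays) and $\mathcal{Q}$ (set of matrices) be as defined in the context. Then $$\min_{Q\in\mathcal{Q}}D(P\|Q)=\min_{\mathbf{P}\in\boldsymbol{\mathcal{P}},\,\mathbf{Q}\in\boldsymbol{\mathcal{Q}}}D(\mathbf{P}\|\mathbf{Q}).$$
   Context: Integers $m,n\ge 1$ and $1\le k\le\min(m,n)$ are fixed; $\mathbb{R}_+=[0,\infty)$. Indices range over $i\in\{1,\dots,m\}$, $l\in\{1,\dots,k\}$, $j\in\{1,\dots,n\}$. For two nonnegative arrays $M=(M_\alpha)$, $N=(N_\alpha)$ of the same shape (vectors, matrices or three-index arrays), the I-divergence is $$D(M\|N)=\sum_{\alpha}\Big(M_\alpha\log\frac{M_\alpha}{N_\alpha}-M_\alpha+N_\alpha\Big)\in[0,\infty],$$ with the conventions $0/0=0$, $0\log 0=0$ and $p/0=\infty$ for $p>0$ (so a term with $M_\alpha=0$ equals $N_\alpha$, and a term with $M_\alpha>0$, $N_\alpha=0$ equals $+\infty$). Given $P\in\mathbb{R}_+^{m\times n}$, define $$\boldsymbol{\mathcal{P}}=\Big\{\mathbf{P}\in\mathbb{R}_+^{m\times k\times n}:\ \sum_l\mathbf{P}(ilj)=P(ij)\ \text{for all } i,j\Big\},$$ $$\boldsymbol{\mathcal{Q}}=\Big\{\mathbf{Q}\in\mathbb{R}_+^{m\times k\times n}:\ \mathbf{Q}(ilj)=Q_-(il)Q_+(lj)\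 \text{for some } Q_-\in\mathbb{R}_+^{m\times k},\ Q_+\in\mathbb{R}_+^{k\times n}\text{ with }\sum_jQ_+(lj)=1\ \text{for all } l\Big\},$$ $$\mathcal{Q}=\Big\{Q\in\mathbb{R}_+^{m\times n}:\ Q(ij)=\sum_l\mathbf{Q}(ilj)\ \text{for all } i,j,\ \text{for some }\mathbf{Q}\in\boldsymbol{\mathcal{Q}}\Big\}.$$ *)

theory Defs
  imports "HOL-Analysis.Analysis"
begin

text \<open>
  Matrices in \<open>\<real>\<^sup>m\<^sup>\<times>\<^sup>n\<close> are \<open>real^'n^'m\<close> and three-index arrays in \<open>\<real>\<^sup>m\<^sup>\<times>\<^sup>k\<^sup>\<times>\<^sup>n\<close> are
  \<open>real^'n^'k^'m\<close>, so that the entry with indices \<open>i, l, j\<close> is \<open>A $ i $ l $ j\<close>.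
\<close>

text \<open>
  The summand \<open>p log (p / q) - p + q\<close> for \<open>p, q \<ge> 0\<close>, with \<open>0 / 0 = 0\<close>, \<open>0 log 0 = 0\<close>,
  \<open>p / 0 = \<infinity>\<close> for \<open>p > 0\<close>.
\<close>
definition idiv_term :: "real \<Rightarrow> real \<Rightarrow> ereal" where
  "idiv_term p q =
    (if p = 0 then ereal q
     else if q = 0 then \<infinity>
     else ereal (p * ln (p / q) - p + q))"

definition idiv2 :: "real^'n^'m \<Rightarrow> real^'n^'m \<Rightarrow> ereal" where
  "idiv2 M N = (\<Sum>i\<in>UNIV. \<Sum>j\<in>UNIV. idiv_term (M $ i $ j) (N $ i $ j))"

definition idiv3 :: "real^'n^'k^'m \<Rightarrow> real^'n^'k^'m \<Rightarrow> ereal" where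
  "idiv3 M N =
    (\<Sum>i\<in>UNIV. \<Sum>l\<in>UNIV. \<Sum>j\<in>UNIV. idiv_term (M $ i $ l $ j) (N $ i $ l $ j))"

definition boldP :: "real^'n^'m \<Rightarrow> (real^'n^'k^'m) set" where
  "boldP P =
    {A. (\<forall>i l j. 0 \<le> A $ i $ l $ j) \<and> (\<forall>i j. (\<Sum>l\<in>UNIV. A $ i $ l $ j) = P $ i $ j)}"

definition boldQ :: "(real^'n^'k^'m) set" where
  "boldQ =
    {B. (\<forall>i l j. 0 \<le> B $ i $ l $ j) \<and>
        (\<exists>(Qm :: real^'k^'m) (Qp :: real^'n^'k).
           (\<forall>i l. 0 \<le> Qm $ i $ l) \<and> (\<forall>l j. 0 \<le> Qp $ l $ j) \<and>
           (\<forall>l. (\<Sum>j\<in>UNIV. Qp $ l $ j) = 1) \<and>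
           (\<forall>i l j. B $ i $ l $ j = Qm $ i $ l * Qp $ l $ j))}"

text \<open>
  The inner index type \<open>'k\<close> does not occur in the type of the matrices, hence the
  \<open>itself\<close> argument.
\<close>
definition calQ :: "'k::finite itself \<Rightarrow> (real^'n^'m) set" where
  "calQ _ =
    {Q. (\<forall>i j. 0 \<le> Q $ i $ j) \<and>
        (\<exists>B \<in> (boldQ :: (real^'n^'k^'m) set). \<forall>i j. Q $ i $ j = (\<Sum>l\<in>UNIV. B $ i $ l $ j))}"

end

theory Submission
  imports Defs "HOL-Real_Asymp.Real_Asymp"
begin

text \<open>
  Merging cells never increases the I-divergence: by the log-sum inequality, a lifted pair
  \<open>(A, B)\<close> whose sums over the middle index are \<open>P\<close> and \<open>Q\<close> satisfies
  \<open>D(A \<parallel> B) \<ge> D(P \<parallel> Q)\<close> (\<open>idiv2_marginal_le\<close>).  Equality is reached for every \<open>B\<close> by splitting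
  each entry of \<open>P\<close> in the proportions of \<open>B\<close>, that is \<open>A(ilj) = P(ij) B(ilj) / Q(ij)\<close>
  (\<open>idiv3_attains_idiv2\<close>).  So partial minimisation of the lifted problem over \<open>A\<close> yields exactly
  the matrix problem, and a minimiser \<open>Q\<close> of the latter, with any \<open>B\<close> above it and the
  proportional \<open>A\<close>, gives a minimiser of the former with the same value.

  What remains is that the matrix problem has a minimiser (\<open>idiv2_minimizer_exists\<close>).  The
  elements of \<open>\<Q>\<close> are the products \<open>Q\<^sub>- Q\<^sub>+\<close> with \<open>Q\<^sub>+\<close> row-stochastic.  The divergence is a
  continuous extended-real function of the factors, even where entries of the product vanish, and
  it grows at least linearly in \<open>Q\<close> while the entries of \<open>Q\<^sub>-\<close> are bounded by row sums of \<open>Q\<close>.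
  Hence only a compact set of factors competes with a reference product of finite divergence.

  Both the log-sum inequality and the growth bound come from one variational bound: the
  divergence term dominates \<open>p log c - q (c - 1)\<close> for every \<open>c > 0\<close>, with equality at
  \<open>c = p / q\<close> when \<open>p\<close> and \<open>q\<close> are positive.
\<close>

section \<open>The scalar divergence term\<close>

text \<open>
  The logarithm lies below its tangent at \<open>1\<close>; apply this at \<open>c q / p\<close>.
\<close>

lemma idiv_term_variational:
  assumes "0 \<le> p" "0 \<le> q" "0 < c"
  shows "ereal (p * ln c - q * (c - 1)) \<le> idiv_term p q"
proof (cases "p = 0 \<or> q = 0")
  case True
  then show ?thesis
    using assms by (auto simp: idiv_term_def algebra_simps)
next
  case False
  with assms have pq: "0 < p" "0 < q"
    by auto
  have "ln (c * q / p) \<le> c * q / p - 1"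
    using pq assms by (intro ln_le_minus_one) auto
  then have "p * ln (c * q / p) \<le> p * (c * q / p - 1)"
    using pq by (intro mult_left_mono) auto
  also have "\<dots> = c * q - p"
    using pq by (simp add: field_simps)
  finally have "p * ln (c * q / p) \<le> c * q - p" .
  moreover have "ln (c * q / p) = ln c - ln (p / q)"
    using pq assms by (simp add: ln_div ln_mult)
  ultimately have "p * ln c - q * (c - 1) \<le> p * ln (p / q) - p + q"
    by (simp add: algebra_simps)
  then show ?thesis
    using pq by (simp add: idiv_term_def)
qed

lemma idiv_term_nonneg:
  assumes "0 \<le> p" "0 \<le> q"
  shows "0 \<le> idiv_term p q"
  using idiv_term_variational[OF assms, of 1] by (simp add: zero_ereal_def)

text \<open>
  The variational bound at \<open>c = 1/2\<close>, where \<open>ln 2 \<le> 1\<close>.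
\<close>

lemma idiv_term_linear_growth:
  assumes "0 \<le> p" "0 \<le> q"
  shows "ereal (q / 2 - p) \<le> idiv_term p q"
proof -
  have "p * ln 2 \<le> p * 1"
    using assms ln_le_minus_one[of "2::real"] by (intro mult_left_mono) auto
  then have "q / 2 - p \<le> p * ln (1/2) - q * (1/2 - 1)"
    by (simp add: ln_div)
  then show ?thesis
    using idiv_term_variational[OF assms, of "1/2"]
    by (meson ereal_less_eq(3) order_trans half_gt_zero zero_less_one)
qed

text \<open>
  Continuity at \<open>0\<close> is where the convention \<open>p / 0 = \<infinity>\<close> enters: for \<open>p > 0\<close> the value
  \<open>\<infinity>\<close> is the limit of the finite values.
\<close>

lemma continuous_on_idiv_term:
  assumes "0 \<le> p"
  shows "continuous_on {0..} (idiv_term p)"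
proof (cases "p = 0")
  case True
  then have "idiv_term p = ereal"
    by (auto simp: idiv_term_def)
  then show ?thesis
    by (simp add: continuous_on_ereal)
next
  case False
  with assms have p: "0 < p"
    by simp
  let ?f = "\<lambda>q. p * ln (p / q) - p + q"
  show ?thesis
    unfolding continuous_on_def
  proof
    fix q :: real
    assume "q \<in> {0..}"
    then consider "q = 0" | "0 < q"
      by fastforce
    then show "(idiv_term p \<longlongrightarrow> idiv_term p q) (at q within {0..})"
    proof cases
      case 1
      have "filterlim ?f at_top (at_right 0)"
        using p by real_asymp
      then have "((\<lambda>q. ereal (?f q)) \<longlongrightarrow> \<infinity>) (at_right 0)"
        by (simp add: tendsto_PInfty_eq_at_top)
      moreover have "\<forall>\<^sub>F q in at_right 0. ereal (?f q) = idiv_term p q"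
        using p by (auto simp: eventually_at_filter idiv_term_def)
      ultimately have "(idiv_term p \<longlongrightarrow> \<infinity>) (at_right 0)"
        by (rule Lim_transform_eventually)
      then show ?thesis
        using 1 p by (simp add: at_within_Ici_at_right idiv_term_def)
    next
      case 2
      have "(?f \<longlongrightarrow> ?f q) (at q)"
        using 2 p by (auto intro!: tendsto_eq_intros)
      then have "((\<lambda>q. ereal (?f q)) \<longlongrightarrow> idiv_term p q) (at q)"
        using 2 p by (simp add: idiv_term_def)
      moreover have "\<forall>\<^sub>F x in at q. ereal (?f x) = idiv_term p x"
        using eventually_at_in_open'[of "{0<..}" q] 2 p
        by (auto elim!: eventually_mono simp: idiv_term_def)
      ultimately have "(idiv_term p \<longlongrightarrow> idiv_term p q) (at q)"
        by (rule Lim_transform_eventually)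
      then show ?thesis
        by (rule filterlim_mono) (auto intro: at_le)
    qed
  qed
qed

section \<open>Merging and splitting cells\<close>

lemma member_le_sum_ereal:
  fixes f :: "'i \<Rightarrow> ereal"
  assumes "finite S" "l \<in> S" "\<And>i. i \<in> S \<Longrightarrow> 0 \<le> f i"
  shows "f l \<le> sum f S"
  using sum_mono2[of S "{l}" f] assms by simp

text \<open>
  The log-sum inequality.  At the merged ratio \<open>c = p / q\<close> the variational bound is an equality for
  the sums \<open>p\<close> and \<open>q\<close>, and it is linear in both arguments, so it is the sum of lower bounds for
  the individual terms.
\<close>

lemma idiv_term_sum_le:
  assumes "finite S" and a: "\<And>l. l \<in> S \<Longrightarrow> 0 \<le> a l" and b: "\<And>l. l \<in> S \<Longrightarrow> 0 \<le> b l"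
  shows "idiv_term (sum a S) (sum b S) \<le> (\<Sum>l\<in>S. idiv_term (a l) (b l))"
proof -
  let ?p = "sum a S" and ?q = "sum b S"
  have pq: "0 \<le> ?p" "0 \<le> ?q"
    using a b by (auto intro: sum_nonneg)
  consider "?p = 0" | "?p \<noteq> 0" "?q = 0" | "0 < ?p" "0 < ?q"
    using pq by fastforce
  then show ?thesis
  proof cases
    case 1
    then have "a l = 0" if "l \<in> S" for l
      using that a \<open>finite S\<close> sum_nonneg_eq_0_iff by metis
    then have "(\<Sum>l\<in>S. idiv_term (a l) (b l)) = (\<Sum>l\<in>S. ereal (b l))"
      by (intro sum.cong) (auto simp: idiv_term_def)
    then show ?thesis
      using 1 by (simp add: idiv_term_def)
  next
    case 2
    then obtain l where l: "l \<in> S" "a l \<noteq> 0"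
      by (meson sum.neutral)
    have "b l = 0"
      using 2 l b \<open>finite S\<close> sum_nonneg_eq_0_iff by metis
    then have "\<infinity> = idiv_term (a l) (b l)"
      using l by (simp add: idiv_term_def)
    also have "\<dots> \<le> (\<Sum>l\<in>S. idiv_term (a l) (b l))"
      using l a b \<open>finite S\<close>
      by (intro member_le_sum_ereal[where f = "\<lambda>l. idiv_term (a l) (b l)"])
        (auto intro: idiv_term_nonneg)
    finally show ?thesis
      by simp
  next
    case 3
    let ?c = "?p / ?q"
    have "idiv_term ?p ?q = ereal (?p * ln ?c - ?q * (?c - 1))"
      using 3 by (simp add: idiv_term_def field_simps)
    also have "\<dots> = (\<Sum>l\<in>S. ereal (a l * ln ?c - b l * (?c - 1)))"
      by (simp add: sum_subtractf sum_distrib_right)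
    also have "\<dots> \<le> (\<Sum>l\<in>S. idiv_term (a l) (b l))"
      using 3 a b by (intro sum_mono idiv_term_variational) auto
    finally show ?thesis .
  qed
qed

text \<open>
  Splitting \<open>p\<close> in the proportions of \<open>b\<close> gives every cell the same ratio \<open>p / q\<close>, so the terms add
  up to the merged one.  If \<open>q = 0\<close> there are no proportions, but then any split will do: both
  sides are \<open>0\<close> or both are infinite.
\<close>

lemma idiv_term_split:
  fixes b :: "'k::finite \<Rightarrow> real"
  assumes p: "0 \<le> p" and b: "\<And>l. 0 \<le> b l"
  obtains a where "\<And>l. 0 \<le> a l" "sum a UNIV = p"
    "(\<Sum>l\<in>UNIV. idiv_term (a l) (b l)) = idiv_term p (sum b UNIV)"
proof -
  define q where "q = sum b UNIV"
  have "0 \<le> q"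
    unfolding q_def using b by (intro sum_nonneg) auto
  then consider "q = 0" | "0 < q"
    by fastforce
  then show thesis
  proof cases
    case 1
    then have b0: "b l = 0" for l
      using b by (simp add: q_def sum_nonneg_eq_0_iff)
    let ?a = "\<lambda>l::'k. p / CARD('k)"
    have "(\<Sum>l\<in>UNIV. idiv_term (?a l) (b l)) = idiv_term p (sum b UNIV)"
    proof (cases "p = 0")
      case True
      then show ?thesis
        by (simp add: b0 idiv_term_def zero_ereal_def[symmetric])
    next
      case False
      then have "(\<Sum>l\<in>UNIV. idiv_term (?a l) (b l)) = (\<Sum>l\<in>(UNIV::'k set). \<infinity>)"
        by (simp add: b0 idiv_term_def)
      then show ?thesis
        using False by (simp add: b0 idiv_term_def sum_Pinfty)
    qed
    then show thesis
      using p by (intro that[of ?a]) auto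
  next
    case 2
    let ?a = "\<lambda>l. p * b l / q"
    have sum_a: "sum ?a UNIV = p"
      using 2 by (simp add: q_def flip: sum_distrib_left sum_divide_distrib)
    have "(\<Sum>l\<in>UNIV. idiv_term (?a l) (b l)) = idiv_term p q"
    proof (cases "p = 0")
      case True
      then show ?thesis
        by (simp add: idiv_term_def q_def)
    next
      case False
      have "idiv_term (?a l) (b l) = ereal (b l * ((p * ln (p / q) - p + q) / q))" for l
        using False 2 by (cases "b l = 0") (auto simp: idiv_term_def field_simps)
      then have "(\<Sum>l\<in>UNIV. idiv_term (?a l) (b l)) = ereal (q * ((p * ln (p / q) - p + q) / q))"
        by (simp only: sum_ereal q_def sum_distrib_right)
      then show ?thesis
        using False 2 by (simp add: idiv_term_def)
    qed
    then show thesis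
      using p b 2 sum_a by (intro that[of ?a]) (auto simp: q_def)
  qed
qed

lemma idiv3_sum_inner:
  "idiv3 A B = (\<Sum>i\<in>UNIV. \<Sum>j\<in>UNIV. \<Sum>l\<in>UNIV. idiv_term (A $ i $ l $ j) (B $ i $ l $ j))"
  unfolding idiv3_def by (intro sum.cong refl sum.swap)

lemma idiv2_marginal_le:
  fixes P Q :: "real^'n^'m" and A B :: "real^'n^'k^'m"
  assumes A: "A \<in> boldP P" and B: "\<And>i l j. 0 \<le> B $ i $ l $ j"
    and Q: "\<And>i j. Q $ i $ j = (\<Sum>l\<in>UNIV. B $ i $ l $ j)"
  shows "idiv2 P Q \<le> idiv3 A B"
  unfolding idiv2_def idiv3_sum_inner
proof (intro sum_mono)
  fix i j
  have P: "P $ i $ j = (\<Sum>l\<in>UNIV. A $ i $ l $ j)" and A_nonneg: "\<And>l. 0 \<le> A $ i $ l $ j"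
    using A by (auto simp: boldP_def)
  show "idiv_term (P $ i $ j) (Q $ i $ j) \<le>
      (\<Sum>l\<in>UNIV. idiv_term (A $ i $ l $ j) (B $ i $ l $ j))"
    unfolding P Q by (intro idiv_term_sum_le A_nonneg B finite)
qed

lemma idiv3_attains_idiv2:
  fixes P Q :: "real^'n^'m" and B :: "real^'n^'k^'m"
  assumes P: "\<And>i j. 0 \<le> P $ i $ j" and B: "\<And>i l j. 0 \<le> B $ i $ l $ j"
    and Q: "\<And>i j. Q $ i $ j = (\<Sum>l\<in>UNIV. B $ i $ l $ j)"
  obtains A where "A \<in> boldP P" "idiv3 A B = idiv2 P Q"
proof -
  have "\<forall>i j. \<exists>a. (\<forall>l. 0 \<le> a l) \<and> sum a UNIV = P $ i $ j \<and>
      (\<Sum>l\<in>UNIV. idiv_term (a l) (B $ i $ l $ j)) = idiv_term (P $ i $ j) (Q $ i $ j)"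
  proof (intro allI)
    fix i j
    obtain a where "\<And>l. 0 \<le> a l" "sum a UNIV = P $ i $ j"
      "(\<Sum>l\<in>UNIV. idiv_term (a l) (B $ i $ l $ j)) =
        idiv_term (P $ i $ j) (\<Sum>l\<in>UNIV. B $ i $ l $ j)"
      using idiv_term_split[of "P $ i $ j" "\<lambda>l. B $ i $ l $ j", OF P B] by blast
    then show "\<exists>a. (\<forall>l. 0 \<le> a l) \<and> sum a UNIV = P $ i $ j \<and>
        (\<Sum>l\<in>UNIV. idiv_term (a l) (B $ i $ l $ j)) = idiv_term (P $ i $ j) (Q $ i $ j)"
      unfolding Q by blast
  qed
  then obtain a where a: "\<forall>i j. (\<forall>l. 0 \<le> a i j l) \<and> sum (a i j) UNIV = P $ i $ j \<and>
      (\<Sum>l\<in>UNIV. idiv_term (a i j l) (B $ i $ l $ j)) = idiv_term (P $ i $ j) (Q $ i $ j)"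
    unfolding choice_iff by blast
  show thesis
    using a by (intro that[of "\<chi> i l j. a i j l"])
      (simp_all add: boldP_def idiv3_sum_inner idiv2_def)
qed

section \<open>Existence of a minimising matrix\<close>

text \<open>
  The minimisation takes place on the pairs \<open>(Q\<^sub>-, Q\<^sub>+)\<close> instead of their products, since
  the constraints on the factors are visibly closed.
\<close>

definition admissible_factors :: "((real^'k^'m) \<times> (real^'n^'k)) set" where
  "admissible_factors =
    {(U, V). (\<forall>i l. 0 \<le> U $ i $ l) \<and> (\<forall>l j. 0 \<le> V $ l $ j) \<and> (\<forall>l. (\<Sum>j\<in>UNIV. V $ l $ j) = 1)}"

lemma admissible_product_nonneg:
  assumes "(U, V) \<in> admissible_factors"
  shows "0 \<le> (U ** V) $ i $ j"
  using assms by (auto simp: admissible_factors_def matrix_matrix_mult_def intro!: sum_nonneg)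

lemma calQ_eq_products:
  "calQ TYPE('k::finite) = (\<lambda>(U, V). U ** V) `
    (admissible_factors :: ((real^'k^'m) \<times> (real^'n^'k)) set)"
  (is "_ = ?R")
proof
  show "calQ TYPE('k) \<subseteq> ?R"
  proof
    fix Q :: "real^'n^'m"
    assume "Q \<in> calQ TYPE('k)"
    then obtain U :: "real^'k^'m" and V :: "real^'n^'k"
      where "(U, V) \<in> admissible_factors" "\<And>i j. Q $ i $ j = (\<Sum>l\<in>UNIV. U $ i $ l * V $ l $ j)"
      by (fastforce simp: calQ_def boldQ_def admissible_factors_def)
    then show "Q \<in> ?R"
      by (intro image_eqI[of _ _ "(U, V)"]) (auto simp: matrix_matrix_mult_def vec_eq_iff)
  qed
  show "?R \<subseteq> calQ TYPE('k)"
  proof clarify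
    fix U :: "real^'k^'m" and V :: "real^'n^'k"
    assume UV: "(U, V) \<in> admissible_factors"
    then have "(\<chi> i l j. U $ i $ l * V $ l $ j) \<in> boldQ"
      unfolding boldQ_def admissible_factors_def by auto
    then show "U ** V \<in> calQ TYPE('k)"
      using admissible_product_nonneg[OF UV]
      by (auto simp: calQ_def matrix_matrix_mult_def
          intro!: bexI[of _ "\<chi> i l j. U $ i $ l * V $ l $ j"])
  qed
qed

lemma continuous_on_sum_ereal_nonneg:
  fixes f :: "'i \<Rightarrow> 'a::topological_space \<Rightarrow> ereal"
  assumes "\<And>i. i \<in> I \<Longrightarrow> continuous_on S (f i)" "\<And>i x. i \<in> I \<Longrightarrow> x \<in> S \<Longrightarrow> 0 \<le> f i x"
  shows "continuous_on S (\<lambda>x. \<Sum>i\<in>I. f i x)"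
  using assms
proof (induction I rule: infinite_finite_induct)
  case (insert i I)
  have not_minf: "y \<noteq> -\<infinity>" if "0 \<le> y" for y :: ereal
    using that by auto
  have "continuous_on S (\<lambda>x. f i x + (\<Sum>i\<in>I. f i x))"
    using insert.IH insert.prems unfolding continuous_on_def
    by (intro ballI tendsto_add_ereal_nonneg) (auto intro!: not_minf sum_nonneg)
  then show ?case
    using insert.hyps by simp
qed auto

lemma continuous_on_idiv2_product:
  fixes P :: "real^'n^'m"
  assumes P: "\<And>i j. 0 \<le> P $ i $ j"
  shows "continuous_on (admissible_factors :: ((real^'k^'m) \<times> (real^'n^'k)) set)
    (\<lambda>(U, V). idiv2 P (U ** V))"
  unfolding idiv2_def case_prod_beta
proof (intro continuous_on_sum_ereal_nonneg sum_nonneg)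
  fix i j
  let ?F = "admissible_factors :: ((real^'k^'m) \<times> (real^'n^'k)) set"
  have "continuous_on ?F (\<lambda>x. (fst x ** snd x) $ i $ j)"
    unfolding matrix_matrix_mult_def by (simp, intro continuous_intros)
  then show "continuous_on ?F (\<lambda>x. idiv_term (P $ i $ j) ((fst x ** snd x) $ i $ j))"
    using admissible_product_nonneg
    by (intro continuous_on_compose2[OF continuous_on_idiv_term]) (auto simp: P)
qed (auto intro!: idiv_term_nonneg P admissible_product_nonneg)

text \<open>
  An entry of \<open>U\<close> is at most a row sum of \<open>U ** V\<close>, because the rows of \<open>V\<close> sum to \<open>1\<close>; the entries
  of \<open>U ** V\<close> are bounded by the linear growth of the divergence.
\<close>

lemma admissible_factor_bound:
  fixes P :: "real^'n^'m" and U :: "real^'k^'m" and V :: "real^'n^'k"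
  assumes P: "\<And>i j. 0 \<le> P $ i $ j"
    and UV: "(U, V) \<in> admissible_factors" and M: "idiv2 P (U ** V) \<le> ereal M"
  shows "U $ i $ l \<le> (\<Sum>j\<in>UNIV. 2 * (M + P $ i $ j))"
proof -
  have nonneg: "0 \<le> U $ i $ l" "0 \<le> V $ l $ j" "(\<Sum>j\<in>UNIV. V $ l $ j) = 1" for i l j
    using UV by (auto simp: admissible_factors_def)
  have entry: "(U ** V) $ i $ j \<le> 2 * (M + P $ i $ j)" for j
  proof -
    let ?t = "\<lambda>i j. idiv_term (P $ i $ j) ((U ** V) $ i $ j)"
    have t: "0 \<le> ?t i j" for i j
      by (intro idiv_term_nonneg P admissible_product_nonneg[OF UV])
    have "ereal ((U ** V) $ i $ j / 2 - P $ i $ j) \<le> ?t i j"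
      by (intro idiv_term_linear_growth P admissible_product_nonneg[OF UV])
    also have "\<dots> \<le> (\<Sum>j\<in>UNIV. ?t i j)"
      using t by (intro member_le_sum_ereal) auto
    also have "\<dots> \<le> (\<Sum>i\<in>UNIV. \<Sum>j\<in>UNIV. ?t i j)"
      using t by (intro member_le_sum_ereal[where f = "\<lambda>i. \<Sum>j\<in>UNIV. ?t i j"])
        (auto intro: sum_nonneg)
    also have "\<dots> \<le> ereal M"
      using M by (simp add: idiv2_def)
    finally show ?thesis
      by simp
  qed
  have "U $ i $ l = (\<Sum>j\<in>UNIV. U $ i $ l * V $ l $ j)"
    by (simp add: nonneg flip: sum_distrib_left)
  also have "\<dots> \<le> (\<Sum>j\<in>UNIV. (U ** V) $ i $ j)"
  proof (intro sum_mono)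
    fix j
    show "U $ i $ l * V $ l $ j \<le> (U ** V) $ i $ j"
      unfolding matrix_matrix_mult_def
      using member_le_sum[of l UNIV "\<lambda>l. U $ i $ l * V $ l $ j"] nonneg by simp
  qed
  also have "\<dots> \<le> (\<Sum>j\<in>UNIV. 2 * (M + P $ i $ j))"
    by (intro sum_mono entry)
  finally show ?thesis .
qed

lemma compact_bounded_admissible_factors:
  "compact {(U, V) \<in> (admissible_factors :: ((real^'k^'m) \<times> (real^'n^'k)) set).
     \<forall>i l. U $ i $ l \<le> C $ i $ l}"
proof -
  have "V $ l $ j \<le> 1" if "\<forall>l j. 0 \<le> V $ l $ j" "\<forall>l. (\<Sum>j\<in>UNIV. V $ l $ j) = 1"
    for V :: "real^'n^'k" and l j
    using that member_le_sum[of j UNIV "\<lambda>j. V $ l $ j"] by simp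
  then have eq: "{(U, V) \<in> (admissible_factors :: ((real^'k^'m) \<times> (real^'n^'k)) set).
      \<forall>i l. U $ i $ l \<le> C $ i $ l} =
    {0..C} \<times> ({0..(\<chi> l j. 1)} \<inter> {V. \<forall>l. (\<Sum>j\<in>UNIV. V $ l $ j) = 1})"
    by (auto simp: admissible_factors_def less_eq_vec_def)
  show ?thesis
    unfolding eq
    by (intro compact_Times compact_Int_closed compact_interval closed_Collect_all
        closed_Collect_eq continuous_intros)
qed

lemma idiv2_minimizer_exists:
  fixes P :: "real^'n^'m"
  assumes P: "\<And>i j. 0 \<le> P $ i $ j"
  obtains Q where "is_arg_min (idiv2 P) (\<lambda>Q. Q \<in> calQ TYPE('k::finite)) Q"
proof -
  let ?F = "admissible_factors :: ((real^'k^'m) \<times> (real^'n^'k)) set"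
  let ?d = "\<lambda>(U :: real^'k^'m, V :: real^'n^'k). idiv2 P (U ** V)"
  \<comment> \<open>A reference product without zero entries, hence of finite divergence.\<close>
  define x0 :: "(real^'k^'m) \<times> (real^'n^'k)" where "x0 = (\<chi> i l. 1, \<chi> l j. 1 / CARD('n))"
  have x0: "x0 \<in> ?F"
    by (simp add: x0_def admissible_factors_def)
  have "idiv_term (P $ i $ j) ((fst x0 ** snd x0) $ i $ j) \<noteq> \<infinity>" for i j
    by (simp add: x0_def matrix_matrix_mult_def idiv_term_def)
  then have "?d x0 \<noteq> \<infinity>"
    by (simp add: idiv2_def sum_Pinfty case_prod_beta)
  moreover have "0 \<le> ?d x0"
    using admissible_product_nonneg[of "fst x0" "snd x0"] x0 P
    by (auto simp: idiv2_def case_prod_beta intro!: sum_nonneg idiv_term_nonneg)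
  ultimately obtain M where M: "?d x0 = ereal M"
    by (cases "?d x0") auto
  define C :: "real^'k^'m" where "C = (\<chi> i l. \<Sum>j\<in>UNIV. 2 * (M + P $ i $ j))"
  define K where "K = {(U, V) \<in> ?F. \<forall>i l. U $ i $ l \<le> C $ i $ l}"
  \<comment> \<open>Whatever is at least as good as the reference point lies in \<open>K\<close>, so minimising over \<open>K\<close>
      suffices.\<close>
  have sublevel: "x \<in> K" if "x \<in> ?F" "?d x \<le> ?d x0" for x
    using that admissible_factor_bound[OF P, of "fst x" "snd x" M]
    by (auto simp: K_def C_def M)
  have "compact K"
    unfolding K_def by (rule compact_bounded_admissible_factors)
  moreover have "x0 \<in> K"
    using sublevel x0 by blast
  moreover have "continuous_on K ?d"
    by (rule continuous_on_subset[OF continuous_on_idiv2_product[OF P]]) (auto simp: K_def)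
  ultimately obtain x where x: "x \<in> K" "\<And>y. y \<in> K \<Longrightarrow> ?d x \<le> ?d y"
    using continuous_attains_inf[of K ?d] by blast
  have "x \<in> ?F"
    using x by (auto simp: K_def)
  have "?d x \<le> ?d y" if "y \<in> ?F" for y
    using sublevel[OF that] x \<open>x0 \<in> K\<close> by (meson linear order_trans)
  then have "is_arg_min (idiv2 P) (\<lambda>Q. Q \<in> calQ TYPE('k)) (fst x ** snd x)"
    using \<open>x \<in> ?F\<close> unfolding is_arg_min_linorder calQ_eq_products by (force simp: case_prod_beta)
  then show thesis
    by (rule that)
qed

section \<open>The two minima agree\<close>

theorem proposition4p3:
  fixes P :: "real^'n^'m"
  assumes "CARD('k::finite) \<le> min CARD('m) CARD('n)"
    and "\<forall>i j. 0 \<le> P $ i $ j"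
  shows "\<exists>(Q :: real^'n^'m) (A :: real^'n^'k^'m) (B :: real^'n^'k^'m).
    is_arg_min (\<lambda>Q'. idiv2 P Q') (\<lambda>Q'. Q' \<in> calQ TYPE('k)) Q \<and>
    is_arg_min (\<lambda>(A', B'). idiv3 A' B') (\<lambda>(A', B'). A' \<in> boldP P \<and> B' \<in> boldQ) (A, B) \<and>
    idiv2 P Q = idiv3 A B"
proof -
  have P: "0 \<le> P $ i $ j" for i j
    using assms(2) by blast
  have boldQ_nonneg: "0 \<le> B $ i $ l $ j" if "B \<in> boldQ" for B :: "real^'n^'k^'m" and i l j
    using that by (simp add: boldQ_def)
  obtain Q where Q: "is_arg_min (idiv2 P) (\<lambda>Q. Q \<in> calQ TYPE('k)) Q"
    using idiv2_minimizer_exists[OF P] by blast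
  then obtain B :: "real^'n^'k^'m"
    where B: "B \<in> boldQ" "\<And>i j. Q $ i $ j = (\<Sum>l\<in>UNIV. B $ i $ l $ j)"
    by (auto simp: is_arg_min_def calQ_def)
  obtain A where A: "A \<in> boldP P" "idiv3 A B = idiv2 P Q"
    using idiv3_attains_idiv2[OF P boldQ_nonneg[OF B(1)] B(2)] by blast
  have "idiv3 A B \<le> idiv3 A' B'" if "A' \<in> boldP P" "B' \<in> boldQ" for A' B' :: "real^'n^'k^'m"
  proof -
    let ?Q' = "\<chi> i j. \<Sum>l\<in>UNIV. B' $ i $ l $ j"
    have "?Q' \<in> calQ TYPE('k)"
      using that(2) by (auto simp: calQ_def intro!: sum_nonneg boldQ_nonneg)
    then have "idiv2 P Q \<le> idiv2 P ?Q'"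
      using Q by (simp add: is_arg_min_linorder)
    also have "\<dots> \<le> idiv3 A' B'"
      using that by (intro idiv2_marginal_le boldQ_nonneg) auto
    finally show ?thesis
      by (simp add: A)
  qed
  then have "is_arg_min (\<lambda>(A', B'). idiv3 A' B') (\<lambda>(A', B'). A' \<in> boldP P \<and> B' \<in> boldQ) (A, B)"
    using A B by (auto simp: is_arg_min_linorder)
  then show ?thesis
    using Q A(2)[symmetric] by (intro exI conjI)
qed

end
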